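(* Let $\mathbf{Z}=[\mathbf{z}_1,\dots,\mathbf{z}_{n+1}]\in\mathbb{C}^{m\times(n+1)}$ be time-series data. Mean-subtracted DMD of $\mathbf{Z}$ is equivalent to temporal DFT if and only if the constant vector $\mathbf{1}_n$ is orthogonal to the null-space $\mathcal{N}(\mathbf{X}_{\rm ms})$, that is, if and only if $$\mathcal{P}_{\mathcal{N}(\mathbf{X}_{\rm ms})}\mathbf{1}_n=\mathbf{0}.$$
   Context: Let $n\ge1$, $\boldsymbol{\mu}=\frac{1}{n+1}\sum_{j=1}^{n+1}\mathbf{z}_j$, $\mathbf{X}_{\rm ms}=[\mathbf{z}_j-\boldsymbol{\mu}]_{j=1}^n\in\mathbb{C}^{m\times n}$, and $\mathbf{c}^*[\mathbf{Z}_{\rm ms}]=\mathbf{X}_{\rm ms}^{\dagger}(\mathbf{z}_{n+1}-\boldsymbol{\mu})\in\mathbb{C}^n$, where $\dagger$ is the Moore-Penrose pseudo-inverse. The mean-subtracted DMD eigenvalues $\{\tilde\lambda_i\}_{i=1}^n$ are the eigenvalues of the $n\times n$ companion matrix with $1$'s on the first sub-diagonal, last column $\mathbf{c}^*[\mathbf{Z}_{\rm ms}]$, and zeros elsewhere. Mean-subtracted DMD is said to be equivalent to (temporal) DFT when $\{\tilde\lambda_i\}_{i=1}^n=\{z\in\mathbb{C}: z\ne1,\ z^{n+1}=1\}$. $\mathbf{1}_n\in\mathbb{C}^n$ is the all-ones vector, and $\mathcal{P}_{\mathcal{W}}$ is the orthogonal projector onto the subspace $\mathcal{W}$ under the standard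 inner product. *)

theory Defs
  imports
    "Jordan_Normal_Form.Matrix_Kernel"
    "Jordan_Normal_Form.Schur_Decomposition"
    "Jordan_Normal_Form.Spectral_Radius"
begin

text \<open>Indices are shifted to start at 0: the snapshots \<open>z\<^sub>1, \<dots>, z\<^sub>n\<^sub>+\<^sub>1\<close> are
  \<open>col Z 0, \<dots>, col Z n\<close>, so that \<open>n = dim_col Z - 1\<close> and \<open>z\<^sub>n\<^sub>+\<^sub>1\<close> is \<open>col Z n\<close>.\<close>

definition temporal_mean :: "complex mat \<Rightarrow> complex vec" where
  "temporal_mean Z =
     (1 / of_nat (dim_col Z)) \<cdot>\<^sub>v vec (dim_row Z) (\<lambda>i. \<Sum>j<dim_col Z. col Z j $ i)"

definition X_ms :: "complex mat \<Rightarrow> complex mat" where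
  "X_ms Z = mat_of_cols (dim_row Z)
     (map (\<lambda>j. col Z j - temporal_mean Z) [0..<dim_col Z - 1])"

definition is_pseudo_inverse :: "complex mat \<Rightarrow> complex mat \<Rightarrow> bool" where
  "is_pseudo_inverse A B \<longleftrightarrow>
     B \<in> carrier_mat (dim_col A) (dim_row A) \<and>
     A * B * A = A \<and> B * A * B = B \<and>
     mat_adjoint (A * B) = A * B \<and> mat_adjoint (B * A) = B * A"

text \<open>By Penrose's theorem exactly one matrix satisfies the four conditions, for every
  rectangular \<open>A\<close>; so the description is never vacuous.\<close>

definition pseudo_inverse :: "complex mat \<Rightarrow> complex mat" where
  "pseudo_inverse A = (THE B. is_pseudo_inverse A B)"

definition c_ms :: "complex mat \<Rightarrow> complex vec" where
  "c_ms Z = pseudo_inverse (X_ms Z) *\<^sub>v (col Z (dim_col Z - 1) - temporal_mean Z)"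

definition companion_mat :: "complex vec \<Rightarrow> complex mat" where
  "companion_mat c = mat (dim_vec c) (dim_vec c)
     (\<lambda>(i, j). if Suc j = dim_vec c then c $ i else if i = Suc j then 1 else 0)"

definition dmd_ms_eigenvalues :: "complex mat \<Rightarrow> complex set" where
  "dmd_ms_eigenvalues Z = spectrum (companion_mat (c_ms Z))"

text \<open>An equality of sets; the right-hand side has \<open>n\<close> elements, so it also
  forces the \<open>n\<close> eigenvalues to be simple.\<close>

definition dmd_ms_equiv_dft :: "complex mat \<Rightarrow> bool" where
  "dmd_ms_equiv_dft Z \<longleftrightarrow>
     dmd_ms_eigenvalues Z = {z. z \<noteq> 1 \<and> z ^ dim_col Z = 1}"

definition ones_vec :: "nat \<Rightarrow> complex vec" where
  "ones_vec n = vec n (\<lambda>_. 1)"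

definition orthogonal_to :: "complex vec \<Rightarrow> complex vec set \<Rightarrow> bool" where
  "orthogonal_to v W \<longleftrightarrow> (\<forall>w\<in>W. v \<bullet>c w = 0)"

text \<open>For a subspace \<open>W\<close> of the space containing \<open>v\<close>, this is the unique
  decomposition of \<open>v\<close> into a part in \<open>W\<close> and a part orthogonal to \<open>W\<close>.\<close>

definition orthogonal_projector :: "complex vec set \<Rightarrow> complex vec \<Rightarrow> complex vec" where
  "orthogonal_projector W v = (THE p. p \<in> W \<and> orthogonal_to (v - p) W)"

end

theory Submission
  imports Defs
begin

text \<open>The columns of \<open>Z - \<mu>\<close> sum to zero, so the last one is \<open>- X_ms *\<^sub>v 1\<close> and
  \<open>c_ms = - (X_ms\<^sup>\<dagger> X_ms) 1\<close>, where \<open>X_ms\<^sup>\<dagger> X_ms\<close> is the orthogonal projection along the kernel of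
  \<open>X_ms\<close>. Hence \<open>1\<close> is orthogonal to the kernel iff \<open>c_ms = - 1\<close>. On the other side, the
  eigenvalues of the companion matrix are the roots of \<open>x\<^sup>n - \<Sum>i<n. c\<^sub>i x\<^sup>i\<close>, and this monic
  polynomial vanishes at all \<open>n\<close> roots of \<open>1 + x + \<dots> + x\<^sup>n\<close> iff the two agree, i.e. iff \<open>c = - 1\<close>.\<close>

section \<open>Conjugate transpose\<close>

lemma dim_mat_adjoint [simp]:
  "dim_row (mat_adjoint A) = dim_col A" "dim_col (mat_adjoint A) = dim_row A"
  by (auto simp: mat_adjoint_def)

lemma mat_adjoint_carrier [simp]:
  "A \<in> carrier_mat r c \<Longrightarrow> mat_adjoint A \<in> carrier_mat c r"
  by (intro carrier_matI) simp_all

lemma index_mat_adjoint [simp]: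
  "i < dim_col A \<Longrightarrow> j < dim_row A \<Longrightarrow> mat_adjoint A $$ (i, j) = conjugate (A $$ (j, i))"
  unfolding mat_adjoint_def by (subst mat_of_rows_index) simp_all

lemma mat_adjoint_mat_adjoint [simp]: "mat_adjoint (mat_adjoint A) = A"
  by (rule eq_matI) auto

lemma mat_adjoint_mult:
  fixes A B :: "'a :: conjugatable_field mat"
  assumes A: "A \<in> carrier_mat r k" and B: "B \<in> carrier_mat k c"
  shows "mat_adjoint (A * B) = mat_adjoint B * mat_adjoint A"
proof (rule eq_matI)
  fix i j assume "i < dim_row (mat_adjoint B * mat_adjoint A)"
    "j < dim_col (mat_adjoint B * mat_adjoint A)"
  then have i: "i < c" and j: "j < r" using A B by auto
  show "mat_adjoint (A * B) $$ (i, j) = (mat_adjoint B * mat_adjoint A) $$ (i, j)"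
    using A B i j
    by (auto simp: scalar_prod_def sum_conjugate conjugate_dist_mul mult.commute intro!: sum.cong)
qed (use A B in auto)

lemma cscalar_prod_mat_adjoint:
  fixes A :: "complex mat"
  assumes A: "A \<in> carrier_mat r c" and v: "v \<in> carrier_vec c" and w: "w \<in> carrier_vec r"
  shows "(A *\<^sub>v v) \<bullet>c w = v \<bullet>c (mat_adjoint A *\<^sub>v w)"
proof -
  have "(A *\<^sub>v v) \<bullet>c w = (\<Sum>i<r. \<Sum>j<c. A $$ (i, j) * v $ j * cnj (w $ i))"
    using assms by (auto simp: scalar_prod_def sum_distrib_right atLeast0LessThan intro!: sum.cong)
  also have "\<dots> = (\<Sum>j<c. \<Sum>i<r. A $$ (i, j) * v $ j * cnj (w $ i))"
    by (rule sum.swap)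
  also have "\<dots> = v \<bullet>c (mat_adjoint A *\<^sub>v w)"
    using assms
    by (auto simp: scalar_prod_def sum_distrib_left atLeast0LessThan mult_ac intro!: sum.cong)
  finally show ?thesis .
qed

text \<open>The diagonal entries of \<open>mat_adjoint Y * Y\<close> are the squared norms of the
  columns of \<open>Y\<close>. This is what allows a left factor \<open>mat_adjoint A\<close> to be
  cancelled below.\<close>

lemma mat_adjoint_mult_self_eq_0D:
  fixes Y :: "complex mat"
  assumes Y: "Y \<in> carrier_mat r c" and 0: "mat_adjoint Y * Y = 0\<^sub>m c c"
  shows "Y = 0\<^sub>m r c"
proof (rule eq_matI)
  fix i j assume "i < dim_row (0\<^sub>m r c :: complex mat)" "j < dim_col (0\<^sub>m r c :: complex mat)"
  then have i: "i < r" and j: "j < c" by auto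
  have "(mat_adjoint Y * Y) $$ (j, j) = col Y j \<bullet>c col Y j"
    using Y j by (auto simp: scalar_prod_def mult.commute intro!: sum.cong)
  then have "col Y j \<bullet>c col Y j = 0" using 0 j by simp
  then have "col Y j = 0\<^sub>v r" using Y by (metis col_dim conjugate_square_eq_0_vec carrier_matD(1))
  then have "col Y j $ i = 0" using i by simp
  then show "Y $$ (i, j) = 0\<^sub>m r c $$ (i, j)" using Y i j by simp
qed (use Y in auto)

section \<open>Generalized inverses\<close>

text \<open>Wedderburn rank reduction: a nonzero entry of \<open>A\<close> yields a one-entry matrix \<open>X\<close> such that
  \<open>A - A X A\<close> has strictly fewer nonzero rows, and a generalized inverse of the latter can be
  turned into one of \<open>A\<close>.\<close>

lemma generalized_inverse_lift:
  fixes A :: "'a :: field mat"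
  assumes A: "A \<in> carrier_mat r c" and X: "X \<in> carrier_mat c r" and G: "G \<in> carrier_mat c r"
    and AG: "(A - A * X * A) * G * (A - A * X * A) = A - A * X * A"
  shows "\<exists>H \<in> carrier_mat c r. A * H * A = A"
proof
  \<comment> \<open>Both \<open>A * ?U\<close> and \<open>?V * A\<close> equal the reduced matrix,
    so sandwiching \<open>G\<close> between \<open>?U\<close> and \<open>?V\<close> turns its
    defining equation into exactly the correction that \<open>X\<close> lacks.\<close>
  let ?U = "1\<^sub>m c - X * A" and ?V = "1\<^sub>m r - A * X"
  have U: "?U \<in> carrier_mat c c" and V: "?V \<in> carrier_mat r r" using A X by auto
  have AU: "A * ?U = A - A * X * A"
    using A X by (simp add: mult_minus_distrib_mat[of _ r c _ c] assoc_mult_mat[of A r c X r A c])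
  have VA: "?V * A = A - A * X * A"
    using A X by (simp add: minus_mult_distrib_mat[of _ r r _ _ c])
  have H: "?U * G * ?V \<in> carrier_mat c r" using U V G by auto
  show "X + ?U * G * ?V \<in> carrier_mat c r" using X H by auto
  have "A * (?U * G * ?V) * A = (A * ?U) * G * (?V * A)"
    using A U V G
    by (simp add: assoc_mult_mat[of _ r c _ r _ c] assoc_mult_mat[of _ c c _ r _ c]
      assoc_mult_mat[of _ r c _ c _ c] assoc_mult_mat[of _ c c _ r _ r]
      assoc_mult_mat[of _ c r _ r _ c] assoc_mult_mat[of _ r c _ c _ r])
  then have *: "A * (?U * G * ?V) * A = A - A * X * A" unfolding AU VA AG .
  have "A * (X + ?U * G * ?V) * A = A * X * A + A * (?U * G * ?V) * A"
    using A X H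
    by (simp add: mult_add_distrib_mat[of _ r c _ r] add_mult_distrib_mat[of _ r r _ _ c])
  also have "\<dots> = A" unfolding * using A X by auto
  finally show "A * (X + ?U * G * ?V) * A = A" .
qed

lemma index_mult_mat_sum:
  assumes "A \<in> carrier_mat r k" "B \<in> carrier_mat k c" "i < r" "j < c"
  shows "(A * B) $$ (i, j) = (\<Sum>l<k. A $$ (i, l) * B $$ (l, j))"
  using assms by (auto simp: scalar_prod_def atLeast0LessThan intro!: sum.cong)

lemma generalized_inverse_exists:
  fixes A :: "'a :: field mat"
  assumes "A \<in> carrier_mat r c"
  shows "\<exists>G \<in> carrier_mat c r. A * G * A = A"
  using assms
proof (induction "card {i. i < r \<and> (\<exists>j<c. A $$ (i, j) \<noteq> 0)}" arbitrary: A rule: less_induct)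
  case less
  note A = less.prems
  show ?case
  proof (cases "\<exists>i<r. \<exists>j<c. A $$ (i, j) \<noteq> 0")
    case False
    then have "A = 0\<^sub>m r c" using A by (intro eq_matI) auto
    then show ?thesis by (intro bexI[of _ "0\<^sub>m c r"]) auto
  next
    case True
    then obtain i j where i: "i < r" and j: "j < c" and ij: "A $$ (i, j) \<noteq> 0" by auto
    \<comment> \<open>The nonzero entry is the reciprocal of the pivot, so \<open>A * X * A\<close>
      is column \<open>j\<close> times row \<open>i\<close> of \<open>A\<close> divided by the
      pivot. Its row \<open>i\<close> is that of \<open>A\<close>, and subtracting it is one
      elimination step.\<close>
    define X where "X = mat c r (\<lambda>(k, l). if k = j \<and> l = i then 1 / A $$ (i, j) else 0)"
    have X: "X \<in> carrier_mat c r" by (simp add: X_def)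
    have AX: "(A * X) $$ (a, l) = (if l = i then A $$ (a, j) / A $$ (i, j) else 0)"
      if "a < r" "l < r" for a l
    proof -
      have "(A * X) $$ (a, l) = (\<Sum>k<c. A $$ (a, k) * X $$ (k, l))"
        by (rule index_mult_mat_sum[OF A X that])
      also have "\<dots> = (\<Sum>k<c. if k = j then (if l = i then A $$ (a, j) / A $$ (i, j) else 0) else 0)"
        by (rule sum.cong) (use that in \<open>auto simp: X_def\<close>)
      finally show ?thesis using j by simp
    qed
    have AXA: "(A * X * A) $$ (a, b) = A $$ (a, j) / A $$ (i, j) * A $$ (i, b)"
      if "a < r" "b < c" for a b
    proof -
      have "(A * X * A) $$ (a, b) = (\<Sum>l<r. (A * X) $$ (a, l) * A $$ (l, b))"
        by (rule index_mult_mat_sum[OF _ A that]) (use A X in auto)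
      also have "\<dots> = (\<Sum>l<r. if l = i then A $$ (a, j) / A $$ (i, j) * A $$ (i, b) else 0)"
        using that AX by (intro sum.cong) auto
      finally show ?thesis using i by simp
    qed
    define B where "B = A - A * X * A"
    have B: "B \<in> carrier_mat r c" using A X by (auto simp: B_def)
    have Bi: "B $$ (a, b) = A $$ (a, b) - A $$ (a, j) / A $$ (i, j) * A $$ (i, b)"
      if "a < r" "b < c" for a b
      unfolding B_def AXA[OF that, symmetric] by (rule index_minus_mat(1)) (use that A X in auto)
    \<comment> \<open>Elimination subtracts from row \<open>k\<close> a multiple of row
      \<open>i\<close> with factor proportional to \<open>A $$ (k, j)\<close>. A zero row therefore
      stays zero, while row \<open>i\<close> itself is cleared.\<close>
    have "{k. k < r \<and> (\<exists>l<c. B $$ (k, l) \<noteq> 0)} \<subseteq> {k. k < r \<and> (\<exists>l<c. A $$ (k, l) \<noteq> 0)}"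
    proof (intro Collect_mono impI conjI; elim conjE exE)
      fix k l assume k: "k < r" and l: "l < c" and "B $$ (k, l) \<noteq> 0"
      then have "A $$ (k, l) \<noteq> 0 \<or> A $$ (k, j) \<noteq> 0" using Bi[OF k l] by auto
      then show "\<exists>l<c. A $$ (k, l) \<noteq> 0" using l j by blast
    qed
    moreover have "i \<notin> {k. k < r \<and> (\<exists>l<c. B $$ (k, l) \<noteq> 0)}"
      using Bi[OF i] ij by auto
    moreover have "i \<in> {k. k < r \<and> (\<exists>l<c. A $$ (k, l) \<noteq> 0)}"
      using i j ij by auto
    ultimately have "{k. k < r \<and> (\<exists>l<c. B $$ (k, l) \<noteq> 0)} \<subset> {k. k < r \<and> (\<exists>l<c. A $$ (k, l) \<noteq> 0)}"
      by blast
    then have "card {k. k < r \<and> (\<exists>l<c. B $$ (k, l) \<noteq> 0)} < card {k. k < r \<and> (\<exists>l<c. A $$ (k, l) \<noteq> 0)}"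
      by (intro psubset_card_mono) auto
    from less.hyps[OF this B] obtain G where "G \<in> carrier_mat c r" "B * G * B = B" by blast
    then show ?thesis unfolding B_def by (rule generalized_inverse_lift[OF A X])
  qed
qed

section \<open>The Moore-Penrose inverse\<close>

text \<open>With \<open>G\<close> a generalized inverse of \<open>A\<^sup>* A\<close>, the matrix \<open>A G A\<^sup>*\<close> is the orthogonal projection
  onto the range of \<open>A\<close>.\<close>

lemma range_projection_exists:
  fixes A :: "complex mat"
  assumes A: "A \<in> carrier_mat r c"
  obtains G where "G \<in> carrier_mat c c" "A * G * mat_adjoint A * A = A"
    "mat_adjoint (A * G * mat_adjoint A) = A * G * mat_adjoint A"
proof -
  let ?A' = "mat_adjoint A"
  let ?H = "?A' * A"
  have A': "?A' \<in> carrier_mat c r" using A by simp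
  have H: "?H \<in> carrier_mat c c" using A A' by auto
  obtain G where G: "G \<in> carrier_mat c c" and HGH: "?H * G * ?H = ?H"
    using generalized_inverse_exists[OF H] by auto
  let ?M = "A * G * ?A'"
  have M: "?M \<in> carrier_mat r r" using A A' G by auto
  \<comment> \<open>The target \<open>?M * A = A\<close> says \<open>A * ?K = 0\<close>. The choice
    of \<open>G\<close> gives only \<open>?H * ?K = 0\<close>; multiplying by the adjoint of
    \<open>?K\<close> shows that \<open>A * ?K\<close> has zero Gram matrix.\<close>
  let ?K = "G * ?H - 1\<^sub>m c"
  have K: "?K \<in> carrier_mat c c" using G H by auto
  have Y: "A * ?K \<in> carrier_mat r c" using A K by auto
  have "?H * ?K = ?H * (G * ?H) - ?H * 1\<^sub>m c"
    by (rule mult_minus_distrib_mat[of _ c c _ c]) (use G H in auto)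
  also have "\<dots> = 0\<^sub>m c c"
    unfolding assoc_mult_mat[OF H G H, symmetric] HGH right_mult_one_mat[OF H]
    by (rule minus_r_inv_mat[OF H])
  finally have HK: "?H * ?K = 0\<^sub>m c c" .
  have "mat_adjoint (A * ?K) * (A * ?K) = mat_adjoint ?K * ?A' * (A * ?K)"
    using mat_adjoint_mult[OF A K] by simp
  also have "\<dots> = mat_adjoint ?K * (?H * ?K)"
    using A A' K assoc_mult_mat[of "mat_adjoint ?K" c c ?A' r "A * ?K" c]
      assoc_mult_mat[of ?A' c r A c ?K c] by (metis Y mat_adjoint_carrier)
  also have "\<dots> = 0\<^sub>m c c" unfolding HK using K by (metis mat_adjoint_carrier right_mult_zero_mat)
  finally have AK: "A * ?K = 0\<^sub>m r c" by (rule mat_adjoint_mult_self_eq_0D[OF Y])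
  have "A * ?K = A * (G * ?H) - A * 1\<^sub>m c"
    by (rule mult_minus_distrib_mat[of _ r c _ c]) (use A G H in auto)
  also have "A * (G * ?H) = ?M * A"
    using A A' G by (simp add: assoc_mult_mat[of _ r c _ c _ c] assoc_mult_mat[of _ r c _ r _ c]
      assoc_mult_mat[of _ c c _ r _ c] assoc_mult_mat[of _ r c _ c _ r])
  finally have MA0: "?M * A - A = 0\<^sub>m r c" using AK A by simp
  have MA: "?M * A = A"
  proof (rule eq_matI)
    fix i j assume "i < dim_row A" "j < dim_col A"
    then have "(?M * A - A) $$ (i, j) = 0" unfolding MA0 using A by simp
    then show "(?M * A) $$ (i, j) = A $$ (i, j)"
      using \<open>i < dim_row A\<close> \<open>j < dim_col A\<close> A M by (simp del: index_mult_mat(1))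
  qed (use A M in auto)
  \<comment> \<open>Although \<open>G\<close> need not be Hermitian, this identity gives
    \<open>?M * mat_adjoint ?M = ?M\<close>, and the left side is visibly Hermitian.\<close>
  have A'M: "?A' * mat_adjoint ?M = ?A'" using mat_adjoint_mult[OF M A] MA by simp
  have "?M * mat_adjoint ?M = A * G * (?A' * mat_adjoint ?M)"
    using assoc_mult_mat[of "A * G" r c ?A' r "mat_adjoint ?M" r] A G M by simp
  then have MM: "?M * mat_adjoint ?M = ?M" unfolding A'M .
  have "mat_adjoint ?M = mat_adjoint (?M * mat_adjoint ?M)" unfolding MM ..
  also have "\<dots> = ?M * mat_adjoint ?M"
    using mat_adjoint_mult[OF M mat_adjoint_carrier[OF M]] by simp
  finally have "mat_adjoint ?M = ?M" unfolding MM .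
  with G MA show ?thesis by (rule that)
qed

text \<open>Compress any generalized inverse \<open>C\<close> between the orthogonal projections
  \<open>M\<close> onto the range of \<open>A\<close> and \<open>N\<close> onto the range of its
  adjoint. Then \<open>B = N * C * M\<close> satisfies \<open>A * B = M\<close> and
  \<open>B * A = N\<close>, which makes both products Hermitian.\<close>

lemma pseudo_inverse_exists: "\<exists>B. is_pseudo_inverse A B"
proof -
  define r c where "r = dim_row A" and "c = dim_col A"
  have A: "A \<in> carrier_mat r c" by (simp add: r_def c_def)
  let ?A' = "mat_adjoint A"
  have A': "?A' \<in> carrier_mat c r" using A by simp
  obtain G where G: "G \<in> carrier_mat c c" and GA: "A * G * ?A' * A = A"
    and Gh: "mat_adjoint (A * G * ?A') = A * G * ?A'"
    by (rule range_projection_exists[OF A])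
  obtain F where F: "F \<in> carrier_mat r r" and FA: "?A' * F * A * ?A' = ?A'"
    and Fh: "mat_adjoint (?A' * F * A) = ?A' * F * A"
    using range_projection_exists[OF A'] by auto
  obtain C where C: "C \<in> carrier_mat c r" and CA: "A * C * A = A"
    using generalized_inverse_exists[OF A] by auto
  define M N where "M = A * G * ?A'" and "N = ?A' * F * A"
  have M: "M \<in> carrier_mat r r" and N: "N \<in> carrier_mat c c"
    using A A' F G by (auto simp: M_def N_def)
  have MA: "M * A = A" using GA by (simp add: M_def)
  have NA: "N * ?A' = ?A'" using FA by (simp add: N_def)
  \<comment> \<open>This is the adjoint of \<open>NA\<close>, since \<open>N\<close> is
    Hermitian.\<close>
  have AN: "A * N = A"
    using mat_adjoint_mult[OF N A'] Fh NA by (simp add: N_def)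
  define B where "B = N * C * M"
  have B: "B \<in> carrier_mat c r" using C M N by (auto simp: B_def)
  have NC: "N * C \<in> carrier_mat c r" using C N by auto
  have "A * B = A * (N * C) * M" unfolding B_def
    by (rule assoc_mult_mat[symmetric, OF A NC M])
  also have "A * (N * C) = A * C"
    using assoc_mult_mat[OF A N C] AN by simp
  also have "A * C * M = A * C * (A * (G * ?A'))" unfolding M_def
    using assoc_mult_mat[OF A G A'] by simp
  also have "\<dots> = A * C * A * (G * ?A')"
    by (rule assoc_mult_mat[symmetric, of _ r r _ c _ r]) (use A A' C G in auto)
  also have "\<dots> = M" unfolding CA M_def using assoc_mult_mat[OF A G A'] by simp
  finally have AB: "A * B = M" .
  have "B * A = N * C * (M * A)" unfolding B_def
    by (rule assoc_mult_mat[OF NC M A])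
  also have "\<dots> = N * (C * A)" unfolding MA by (rule assoc_mult_mat[OF N C A])
  also have "\<dots> = ?A' * F * (A * (C * A))" unfolding N_def
    by (rule assoc_mult_mat[of _ c r _ c _ c]) (use A A' C F in auto)
  also have "A * (C * A) = A" using assoc_mult_mat[OF A C A] CA by simp
  finally have BA: "B * A = N" by (simp add: N_def)
  have "N * N = ?A' * F * (A * N)" unfolding N_def
    by (rule assoc_mult_mat[of _ c r _ c _ c]) (use A A' F in auto)
  then have NN: "N * N = N" unfolding AN by (simp add: N_def)
  have "N * B = N * (N * C) * M" unfolding B_def
    by (rule assoc_mult_mat[symmetric, OF N NC M])
  also have "\<dots> = B" using assoc_mult_mat[OF N N C] NN by (simp add: B_def)
  finally have NB: "N * B = B" .
  have "mat_adjoint M = M" "mat_adjoint N = N" using Gh Fh unfolding M_def N_def .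
  moreover have "B \<in> carrier_mat (dim_col A) (dim_row A)" using B by (simp add: r_def c_def)
  ultimately have "is_pseudo_inverse A B" unfolding is_pseudo_inverse_def AB BA MA NB by blast
  then show ?thesis by blast
qed

text \<open>The Hermitian conditions force \<open>A * B = A * C\<close> and
  \<open>B * A = C * A\<close>; then
  \<open>B = B * A * B = C * A * B = C * A * C = C\<close>.\<close>

lemma pseudo_inverse_unique:
  assumes "is_pseudo_inverse A B" "is_pseudo_inverse A C"
  shows "B = C"
proof -
  define r c where "r = dim_row A" and "c = dim_col A"
  have A: "A \<in> carrier_mat r c" by (simp add: r_def c_def)
  have B: "B \<in> carrier_mat c r" and C: "C \<in> carrier_mat c r"
    and ABA: "A * B * A = A" and ACA: "A * C * A = A"
    and BAB: "B * A * B = B" and CAC: "C * A * C = C"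
    and h: "mat_adjoint (A * B) = A * B" "mat_adjoint (A * C) = A * C"
      "mat_adjoint (B * A) = B * A" "mat_adjoint (C * A) = C * A"
    using assms unfolding is_pseudo_inverse_def r_def c_def by argo+
  have AB: "A * B \<in> carrier_mat r r" and AC: "A * C \<in> carrier_mat r r"
    and BA: "B * A \<in> carrier_mat c c" and CA: "C * A \<in> carrier_mat c c" using A B C by auto
  have "A * B = A * C * A * B" by (simp add: ACA)
  also have "\<dots> = A * C * (A * B)" by (rule assoc_mult_mat[OF AC A B])
  finally have e: "A * C * (A * B) = A * B" by (rule sym)
  \<comment> \<open>Taking adjoints swaps the two Hermitian factors, after which
    \<open>A * B * A = A\<close> absorbs \<open>B\<close> instead of \<open>C\<close>.\<close>
  have "A * B = mat_adjoint (A * C * (A * B))" unfolding e h ..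
  also have "\<dots> = A * B * (A * C)" unfolding mat_adjoint_mult[OF AC AB] h ..
  also have "\<dots> = A * B * A * C" by (rule assoc_mult_mat[symmetric, OF AB A C])
  finally have 1: "A * B = A * C" by (simp add: ABA)
  have 2: "A * (B * A) = A" "A * (C * A) = A"
    unfolding assoc_mult_mat[OF A B A, symmetric] assoc_mult_mat[OF A C A, symmetric] ABA ACA by auto
  have "B * A = B * (A * (C * A))" unfolding 2 ..
  also have "\<dots> = B * A * (C * A)" by (rule assoc_mult_mat[symmetric, OF B A CA])
  finally have f: "B * A * (C * A) = B * A" by (rule sym)
  have "B * A = mat_adjoint (B * A * (C * A))" unfolding f h ..
  also have "\<dots> = C * A * (B * A)" unfolding mat_adjoint_mult[OF BA CA] h ..
  also have "\<dots> = C * (A * (B * A))" by (rule assoc_mult_mat[OF C A BA])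
  finally have 3: "B * A = C * A" unfolding 2 .
  have "B = C * A * B" unfolding 3[symmetric] BAB ..
  also have "\<dots> = C * (A * B)" by (rule assoc_mult_mat[OF C A B])
  also have "\<dots> = C * A * C" unfolding 1 by (rule assoc_mult_mat[symmetric, OF C A C])
  finally show ?thesis unfolding CAC .
qed

lemma is_pseudo_inverse_pseudo_inverse: "is_pseudo_inverse A (pseudo_inverse A)"
  unfolding pseudo_inverse_def
  by (rule theI') (use pseudo_inverse_exists pseudo_inverse_unique in blast)

section \<open>Orthogonality to the kernel\<close>

text \<open>From \<open>A * B * A = A\<close>, the vectors \<open>v\<close> and
  \<open>B * A *\<^sub>v v\<close> have the same image under \<open>A\<close>. Being Hermitian and
  zero on the kernel, \<open>B * A\<close> has range orthogonal to the kernel.\<close>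

lemma hermitian_projection_kernel:
  fixes A N :: "complex mat"
  assumes A: "A \<in> carrier_mat r c" and B: "B \<in> carrier_mat c r"
    and ABA: "A * B * A = A" and h: "mat_adjoint (B * A) = B * A"
    and v: "v \<in> carrier_vec c"
  defines "p \<equiv> v - B * A *\<^sub>v v"
  shows "p \<in> mat_kernel A" "orthogonal_to (v - p) (mat_kernel A)"
proof -
  have BA: "B * A \<in> carrier_mat c c" using A B by auto
  have q: "B * A *\<^sub>v v \<in> carrier_vec c" using BA v by simp
  have "A *\<^sub>v (B * A *\<^sub>v v) = A * (B * A) *\<^sub>v v"
    by (rule assoc_mult_mat_vec[symmetric, OF A BA v])
  also have "A * (B * A) = A" using assoc_mult_mat[OF A B A] ABA by simp
  finally have "A *\<^sub>v (B * A *\<^sub>v v) = A *\<^sub>v v" .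
  then have "A *\<^sub>v p = 0\<^sub>v r"
    unfolding p_def using A v q by (simp add: mult_minus_distrib_mat_vec[OF A v q])
  then show "p \<in> mat_kernel A" using q v by (intro mat_kernelI[OF A]) (auto simp: p_def)
  have vp: "v - p = B * A *\<^sub>v v" using v q by (auto simp: p_def)
  show "orthogonal_to (v - p) (mat_kernel A)" unfolding orthogonal_to_def vp
  proof
    fix w assume "w \<in> mat_kernel A"
    then have w: "w \<in> carrier_vec c" and Aw: "A *\<^sub>v w = 0\<^sub>v r" using mat_kernelD[OF A] by auto
    have "B * A *\<^sub>v w = 0\<^sub>v c" 
      unfolding assoc_mult_mat_vec[OF B A w] Aw using B by (intro eq_vecI) auto
    then show "(B * A *\<^sub>v v) \<bullet>c w = 0"
      using cscalar_prod_mat_adjoint[OF BA v w] h v by simp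
  qed
qed

text \<open>The difference of two candidates lies in the kernel and is orthogonal to it, hence to
  itself.\<close>

lemma orthogonal_to_kernel_unique:
  fixes A :: "complex mat"
  assumes A: "A \<in> carrier_mat r c" and v: "v \<in> carrier_vec c"
    and p: "p \<in> mat_kernel A" "orthogonal_to (v - p) (mat_kernel A)"
    and q: "q \<in> mat_kernel A" "orthogonal_to (v - q) (mat_kernel A)"
  shows "p = q"
proof -
  have pc: "p \<in> carrier_vec c" and qc: "q \<in> carrier_vec c"
    using p q mat_kernelD[OF A] by auto
  let ?d = "p - q"
  have d: "?d \<in> carrier_vec c" using pc qc by auto
  have "A *\<^sub>v ?d = 0\<^sub>v r"
    using mult_minus_distrib_mat_vec[OF A pc qc] mat_kernelD(2)[OF A] p q by simp
  then have dk: "?d \<in> mat_kernel A" by (rule mat_kernelI[OF A d])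
  have "?d = (v - q) - (v - p)" using v pc qc by auto
  then have "?d \<bullet>c ?d = (v - q) \<bullet>c ?d - (v - p) \<bullet>c ?d"
    using v pc qc d by (metis minus_carrier_vec minus_scalar_prod_distrib carrier_vec_conjugate)
  also have "\<dots> = 0" using p q dk by (simp add: orthogonal_to_def)
  finally have "?d = 0\<^sub>v c" using d by simp
  show ?thesis
  proof (rule eq_vecI)
    fix i assume i: "i < dim_vec q"
    then have "?d $ i = 0" using \<open>?d = 0\<^sub>v c\<close> qc by simp
    then show "p $ i = q $ i" using i pc qc by simp
  qed (use pc qc in auto)
qed

lemma orthogonal_projector_kernel:
  fixes A :: "complex mat"
  assumes A: "A \<in> carrier_mat r c" and v: "v \<in> carrier_vec c"
  shows "orthogonal_projector (mat_kernel A) v = v - pseudo_inverse A * A *\<^sub>v v"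
proof -
  have "pseudo_inverse A \<in> carrier_mat c r" "A * pseudo_inverse A * A = A"
    "mat_adjoint (pseudo_inverse A * A) = pseudo_inverse A * A"
    using is_pseudo_inverse_pseudo_inverse[of A] A by (auto simp: is_pseudo_inverse_def)
  from hermitian_projection_kernel[OF A this v] show ?thesis
    unfolding orthogonal_projector_def
    by (intro the_equality conjI) (use orthogonal_to_kernel_unique[OF A v] in auto)
qed

text \<open>The zero vector lies in the kernel, so by uniqueness it is the projection exactly when
  \<open>v - 0\<close> is orthogonal to the kernel.\<close>

lemma orthogonal_projector_kernel_eq_0_iff:
  fixes A :: "complex mat"
  assumes A: "A \<in> carrier_mat r c" and v: "v \<in> carrier_vec c"
  shows "orthogonal_projector (mat_kernel A) v = 0\<^sub>v c \<longleftrightarrow> orthogonal_to v (mat_kernel A)"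
proof -
  let ?p = "orthogonal_projector (mat_kernel A) v"
  have "pseudo_inverse A \<in> carrier_mat c r" "A * pseudo_inverse A * A = A"
    "mat_adjoint (pseudo_inverse A * A) = pseudo_inverse A * A"
    using is_pseudo_inverse_pseudo_inverse[of A] A by (auto simp: is_pseudo_inverse_def)
  from hermitian_projection_kernel[OF A this v]
  have p: "?p \<in> mat_kernel A" "orthogonal_to (v - ?p) (mat_kernel A)"
    unfolding orthogonal_projector_kernel[OF A v] .
  have 0: "0\<^sub>v c \<in> mat_kernel A" using A by (intro mat_kernelI[OF A]) auto
  have v0: "v - 0\<^sub>v c = v" using v by auto
  show ?thesis
    using p orthogonal_to_kernel_unique[OF A v p 0] by (auto simp: v0)
qed

section \<open>Eigenvalues of the companion matrix\<close>

text \<open>The left eigenvectors are the Vandermonde vectors \<open>(1, z, \<dots>, z\<^sup>n\<^sup>-\<^sup>1)\<close>, so the transpose is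
  easier to analyse.\<close>

lemma eigenvalue_companion_mat:
  assumes n: "dim_vec c = n" "n \<ge> 1"
  shows "eigenvalue (companion_mat c) z \<longleftrightarrow> z ^ n = (\<Sum>i<n. c $ i * z ^ i)"
proof -
  define T where "T = transpose_mat (companion_mat c)"
  have C: "companion_mat c \<in> carrier_mat n n" using n by (simp add: companion_mat_def)
  then have T: "T \<in> carrier_mat n n" by (simp add: T_def)
  have Tv: "(T *\<^sub>v v) $ j = (if Suc j = n then \<Sum>i<n. c $ i * v $ i else v $ Suc j)"
    if v: "v \<in> carrier_vec n" and j: "j < n" for v j
  proof -
    have "(T *\<^sub>v v) $ j = (\<Sum>i<n. companion_mat c $$ (i, j) * v $ i)"
      using T C v j by (auto simp: T_def scalar_prod_def atLeast0LessThan intro!: sum.cong)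
    also have "\<dots> = (\<Sum>i<n. if Suc j = n then c $ i * v $ i else if i = Suc j then v $ Suc j else 0)"
      using n j by (auto simp: companion_mat_def intro!: sum.cong)
    also have "\<dots> = (if Suc j = n then \<Sum>i<n. c $ i * v $ i else v $ Suc j)"
      using j by auto
    finally show ?thesis .
  qed
  \<comment> \<open>A matrix and its transpose have the same characteristic polynomial.\<close>
  have "eigenvalue (companion_mat c) z \<longleftrightarrow> eigenvalue T z"
    using C T by (simp add: eigenvalue_root_char_poly T_def)
  also have "\<dots> \<longleftrightarrow> z ^ n = (\<Sum>i<n. c $ i * z ^ i)"
  proof
    assume "eigenvalue T z"
    then obtain v where v: "v \<in> carrier_vec n" and v0: "v \<noteq> 0\<^sub>v n" and Tz: "T *\<^sub>v v = z \<cdot>\<^sub>v v"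
      using T by (auto simp: eigenvalue_def eigenvector_def)
    \<comment> \<open>All rows of \<open>T\<close> but the last shift the coordinates, so an
      eigenvector is a geometric progression determined by \<open>v $ 0\<close>. The last row then
      gives the polynomial equation.\<close>
    have pow: "v $ j = z ^ j * v $ 0" if "j < n" for j
      using that
    proof (induction j)
      case (Suc j)
      have "v $ Suc j = (T *\<^sub>v v) $ j" using Tv[OF v, of j] Suc.prems by simp
      then show ?case using Suc Tz v by simp
    qed simp
    have "v $ 0 \<noteq> 0"
    proof
      assume "v $ 0 = 0"
      then have "v = 0\<^sub>v n" using v pow by (intro eq_vecI) auto
      with v0 show False ..
    qed
    have "(T *\<^sub>v v) $ (n - 1) = z * v $ (n - 1)" using v n Tz by simp
    then have "(\<Sum>i<n. c $ i * v $ i) = z * v $ (n - 1)" using Tv[OF v, of "n - 1"] n by simp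
    also have "\<dots> = z ^ n * v $ 0" 
    proof -
      obtain k where k: "n = Suc k" using n(2) by (cases n) auto
      have "v $ k = z ^ k * v $ 0" by (rule pow) (simp add: k)
      then show ?thesis unfolding k diff_Suc_1 by simp
    qed
    also have "(\<Sum>i<n. c $ i * v $ i) = (\<Sum>i<n. c $ i * z ^ i) * v $ 0"
      unfolding sum_distrib_right
    proof (rule sum.cong)
      fix i assume "i \<in> {..<n}"
      then have "v $ i = z ^ i * v $ 0" using pow by blast
      then show "c $ i * v $ i = c $ i * z ^ i * v $ 0" by (metis mult.assoc)
    qed simp
    finally show "z ^ n = (\<Sum>i<n. c $ i * z ^ i)" using \<open>v $ 0 \<noteq> 0\<close> by simp
  next
    assume z: "z ^ n = (\<Sum>i<n. c $ i * z ^ i)"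
    define v where "v = vec n (\<lambda>i. z ^ i)"
    have v: "v \<in> carrier_vec n" by (simp add: v_def)
    have "T *\<^sub>v v = z \<cdot>\<^sub>v v"
    proof (rule eq_vecI)
      fix j assume "j < dim_vec (z \<cdot>\<^sub>v v)"
      then have j: "j < n" by (simp add: v_def)
      have "(\<Sum>i<n. c $ i * v $ i) = z ^ n" unfolding z by (simp add: v_def)
      then show "(T *\<^sub>v v) $ j = (z \<cdot>\<^sub>v v) $ j" using Tv[OF v j] j by (auto simp: v_def)
    qed (use T v in auto)
    moreover have "v \<noteq> 0\<^sub>v n"
    proof
      assume "v = 0\<^sub>v n"
      then have "v $ 0 = 0" using n by simp
      then show False using n by (simp add: v_def)
    qed
    ultimately show "eigenvalue T z" using T v by (auto simp: eigenvalue_def eigenvector_def)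
  qed
  finally show ?thesis .
qed

text \<open>By the geometric sum, both sides say \<open>1 + z + ... + z^n = 0\<close>; at
  \<open>z = 1\<close> this sum is \<open>n + 1\<close>, not zero. The right side is shaped like the
  eigenvalue equation with all coefficients \<open>- 1\<close>.\<close>

lemma root_of_unity_iff_sum_power:
  fixes z :: complex
  shows "z \<noteq> 1 \<and> z ^ (n + 1) = 1 \<longleftrightarrow> z ^ n = (\<Sum>i<n. - 1 * z ^ i)"
proof -
  have "z \<noteq> 1 \<and> z ^ (n + 1) = 1 \<longleftrightarrow> (\<Sum>i<n + 1. z ^ i) = 0"
    using geometric_sum[of z "n + 1"]
    by (cases "z = 1") (auto simp: add_eq_0_iff simp flip: of_nat_Suc of_nat_add)
  also have "\<dots> \<longleftrightarrow> z ^ n = (\<Sum>i<n. - 1 * z ^ i)"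
    by (simp add: sum_negf add_eq_0_iff)
  finally show ?thesis .
qed

text \<open>A nonzero polynomial of degree below \<open>n\<close> cannot have \<open>n\<close>
  distinct roots.\<close>

lemma poly_function_zero_coeffs:
  fixes a :: "nat \<Rightarrow> complex"
  assumes S: "card S = n" "n \<ge> 1" and z: "\<And>z. z \<in> S \<Longrightarrow> (\<Sum>i<n. a i * z ^ i) = 0" and i: "i < n"
  shows "a i = 0"
proof -
  define p where "p = (\<Sum>i<n. monom (a i) i)"
  have coeff: "coeff p k = (if k < n then a k else 0)" for k
    by (auto simp: p_def coeff_sum if_distrib[of "\<lambda>x. _ x"] if_distrib cong: if_cong)
  have "p = 0"
  proof (rule ccontr)
    assume "p \<noteq> 0"
    have "S \<subseteq> {z. poly p z = 0}" using z by (auto simp: p_def poly_sum poly_monom)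
    then have "n \<le> card {z. poly p z = 0}"
      using S \<open>p \<noteq> 0\<close> poly_roots_finite by (metis card_mono)
    also have "\<dots> \<le> degree p" by (rule card_poly_roots_bound[OF \<open>p \<noteq> 0\<close>])
    also have "\<dots> < n"
      using S coeff[of "degree p"] \<open>p \<noteq> 0\<close> by (metis leading_coeff_0_iff)
    finally show False by simp
  qed
  then show ?thesis using coeff[of i] i by simp
qed

text \<open>Subtracting the two equations for \<open>z ^ n\<close> cancels the leading term. What
  remains has degree below \<open>n\<close>, coefficients \<open>c $ i + 1\<close>, and vanishes at
  the \<open>n\<close> nontrivial roots of unity.\<close>

lemma spectrum_companion_mat_roots_of_unity_iff:
  assumes c: "c \<in> carrier_vec n" and n: "n \<ge> 1"
  shows "spectrum (companion_mat c) = {z. z \<noteq> 1 \<and> z ^ (n + 1) = 1} \<longleftrightarrow> c = - ones_vec n"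
proof -
  have spec: "spectrum (companion_mat c) = {z. z ^ n = (\<Sum>i<n. c $ i * z ^ i)}"
    using eigenvalue_companion_mat[of c n] c n by (auto simp: spectrum_def)
  let ?S = "{z :: complex. z \<noteq> 1 \<and> z ^ (n + 1) = 1}"
  have "?S = {z. z ^ (n + 1) = 1} - {1}" by auto
  then have card: "card ?S = n"
    using card_roots_unity_eq[of "n + 1"] by (simp add: card_Diff_singleton)
  show ?thesis
  proof
    assume eq: "spectrum (companion_mat c) = ?S"
    have "c $ i + 1 = 0" if "i < n" for i
    proof (rule poly_function_zero_coeffs[OF card n _ that])
      fix z assume zS: "z \<in> ?S"
      then have "z ^ n = (\<Sum>i<n. c $ i * z ^ i)" using eq spec by blast
      moreover have "z ^ n = (\<Sum>i<n. - 1 * z ^ i)" using zS root_of_unity_iff_sum_power by blast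
      ultimately show "(\<Sum>i<n. (c $ i + 1) * z ^ i) = 0"
        by (simp add: distrib_right sum.distrib sum_negf flip: eq_neg_iff_add_eq_0)
    qed
    then show "c = - ones_vec n"
      using c by (intro eq_vecI) (auto simp: ones_vec_def add_eq_0_iff2)
  next
    assume "c = - ones_vec n"
    then have "(\<Sum>i<n. c $ i * z ^ i) = (\<Sum>i<n. - 1 * z ^ i)" for z
      by (intro sum.cong) (auto simp: ones_vec_def)
    then show "spectrum (companion_mat c) = ?S"
      unfolding spec using root_of_unity_iff_sum_power by auto
  qed
qed

section \<open>Mean-subtracted data\<close>

lemma X_ms_carrier:
  "Z \<in> carrier_mat m (n + 1) \<Longrightarrow> X_ms Z \<in> carrier_mat m n"
  by (auto simp: X_ms_def)

lemma last_snapshot_eq: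
  assumes Z: "Z \<in> carrier_mat m (n + 1)"
  shows "col Z n - temporal_mean Z = - (X_ms Z *\<^sub>v ones_vec n)"
proof (rule eq_vecI)
  fix i assume "i < dim_vec (- (X_ms Z *\<^sub>v ones_vec n))"
  then have i: "i < m" using X_ms_carrier[OF Z] by simp
  define \<mu> where "\<mu> = temporal_mean Z $ i"
  have dim: "dim_vec (temporal_mean Z) = m" using Z by (simp add: temporal_mean_def)
  have "\<mu> = (\<Sum>j<n + 1. Z $$ (i, j)) / of_nat (n + 1)"
    using Z i by (simp add: \<mu>_def temporal_mean_def)
  then have "of_nat (n + 1) * \<mu> = (\<Sum>j<n + 1. Z $$ (i, j))"
    by (metis nonzero_mult_div_cancel_left of_nat_eq_0_iff add_is_0 one_neq_zero times_divide_eq_right)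
  then have mean: "of_nat n * \<mu> + \<mu> = (\<Sum>j<n. Z $$ (i, j)) + Z $$ (i, n)"
    by (simp add: algebra_simps)
  have X: "X_ms Z $$ (i, j) = Z $$ (i, j) - \<mu>" if "j < n" for j
    using Z i that dim by (simp add: X_ms_def mat_of_cols_index \<mu>_def)
  have "(X_ms Z *\<^sub>v ones_vec n) $ i = (\<Sum>j<n. Z $$ (i, j) - \<mu>)"
    using X_ms_carrier[OF Z] i X
    by (auto simp: scalar_prod_def ones_vec_def atLeast0LessThan intro!: sum.cong)
  also have "\<dots> = (\<Sum>j<n. Z $$ (i, j)) - of_nat n * \<mu>" by (simp add: sum_subtractf)
  also have "\<dots> = - (Z $$ (i, n) - \<mu>)" using mean by (simp add: algebra_simps)
  finally show "(col Z n - temporal_mean Z) $ i = (- (X_ms Z *\<^sub>v ones_vec n)) $ i"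
    using Z i dim X_ms_carrier[OF Z] by (simp add: \<mu>_def del: index_mult_mat_vec)
qed (use Z X_ms_carrier[OF Z] in \<open>auto simp: temporal_mean_def\<close>)

text \<open>Rewriting \<open>- ?P * ?X\<close> as \<open>(1 - ?P * ?X) - 1\<close> exposes the
  kernel projector, so the deviation of \<open>c_ms Z\<close> from \<open>- ones_vec n\<close> is
  precisely the projection of the constant vector.\<close>

lemma c_ms_eq:
  assumes Z: "Z \<in> carrier_mat m (n + 1)"
  shows "c_ms Z = orthogonal_projector (mat_kernel (X_ms Z)) (ones_vec n) - ones_vec n"
proof -
  let ?X = "X_ms Z" and ?P = "pseudo_inverse (X_ms Z)"
  have X: "?X \<in> carrier_mat m n" by (rule X_ms_carrier[OF Z])
  have P: "?P \<in> carrier_mat n m"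
    using is_pseudo_inverse_pseudo_inverse[of ?X] X by (auto simp: is_pseudo_inverse_def)
  have o: "ones_vec n \<in> carrier_vec n" by (simp add: ones_vec_def)
  have "c_ms Z = ?P *\<^sub>v (- (?X *\<^sub>v ones_vec n))"
    using Z last_snapshot_eq[OF Z] by (simp add: c_ms_def)
  also have "\<dots> = - (?P *\<^sub>v (?X *\<^sub>v ones_vec n))"
    using P X by (intro eq_vecI) auto
  also have "?P *\<^sub>v (?X *\<^sub>v ones_vec n) = ?P * ?X *\<^sub>v ones_vec n"
    by (rule assoc_mult_mat_vec[symmetric, OF P X o])
  also have "- \<dots> = (ones_vec n - ?P * ?X *\<^sub>v ones_vec n) - ones_vec n"
    using P X o by (intro eq_vecI) (auto simp del: index_mult_mat_vec)
  finally show ?thesis by (simp add: orthogonal_projector_kernel[OF X o])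
qed

theorem theorem4p1:
  fixes Z :: "complex mat" and m n :: nat
  assumes "n \<ge> 1" and "Z \<in> carrier_mat m (n + 1)"
  shows "(dmd_ms_equiv_dft Z \<longleftrightarrow> orthogonal_to (ones_vec n) (mat_kernel (X_ms Z))) \<and>
         (dmd_ms_equiv_dft Z \<longleftrightarrow>
            orthogonal_projector (mat_kernel (X_ms Z)) (ones_vec n) = 0\<^sub>v n)"
proof -
  let ?X = "X_ms Z" and ?p = "orthogonal_projector (mat_kernel (X_ms Z)) (ones_vec n)"
  have X: "?X \<in> carrier_mat m n" by (rule X_ms_carrier[OF assms(2)])
  have o: "ones_vec n \<in> carrier_vec n" by (simp add: ones_vec_def)
  have p: "?p \<in> carrier_vec n"
    using orthogonal_projector_kernel[OF X o] is_pseudo_inverse_pseudo_inverse[of ?X] X o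
    by (auto simp: is_pseudo_inverse_def)
  have c: "c_ms Z = ?p - ones_vec n" by (rule c_ms_eq[OF assms(2)])
  \<comment> \<open>The exponent \<open>dim_col Z\<close> in the definition is \<open>n + 1\<close>,
    matching the roots of unity in the companion matrix criterion.\<close>
  have "dmd_ms_equiv_dft Z \<longleftrightarrow> c_ms Z = - ones_vec n"
    using spectrum_companion_mat_roots_of_unity_iff[of "c_ms Z" n] assms c p o
    by (auto simp: dmd_ms_equiv_dft_def dmd_ms_eigenvalues_def)
  also have "\<dots> \<longleftrightarrow> ?p = 0\<^sub>v n"
    unfolding c using p o by (auto simp: vec_eq_iff ones_vec_def)
  finally show ?thesis using orthogonal_projector_kernel_eq_0_iff[OF X o] by simp
qed

end
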